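(* Let $\alpha,\beta>-1$, $0<k<\beta+1$ and $\ell\in\mathbb N$. Let $E$ be the differential operator $$E=(1-u)(Q_0+uQ_1)\frac{d^2}{du^2}+(P_0+uP_1)\frac{d}{du}-(\alpha+2\ell+3k)V,$$ with $$Q_0=\sum_{i=0}^\ell3iE_{i,i-1},\qquad Q_1=\sum_{i=0}^\ell(\alpha-\ell+3i)E_{ii},$$ $$P_0=\sum_{i=0}^\ell\big((\alpha+2\ell)(\beta+1+2i)-3k(\ell-i)-3i(\beta-k+i)\big)E_{ii}-\sum_{i=0}^\ell i(3i+3\beta-3k+3+\ell+2\alpha)E_{i,i-1},$$ $$P_1=-\sum_{i=0}^\ell(\alpha-\ell+3i)(\alpha+\beta+\ell+i+2)E_{ii}+\sum_{i=0}^\ell3(\beta-k+1+i)(\ell-i)E_{i,i+1},$$ $$V=\sum_{i=0}^\ell i(\alpha+\beta-k+1+i)E_{ii}-\sum_{i=0}^{\ell-1}(\ell-i)(\beta-k+1+i)E_{i,i+1}.$$ Then $E$ is symmetric with respect to the weight matrix $W(u)=(1-u)^\alpha u^\beta Z(u)$ on $(0,1)$, where $$Z(u)=\sum_{i,j=0}^\ell\Big(\sum_{r=0}^\ell\binom ri\binom rj\binom{\ell+k-1-r}{\ell-r}\binom{\beta-k+r}{r}(1-u)^{\ell-r}u^{i+j}\Big)E_{ij}.$$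
   Context: Matrices are $(\ell+1)\times(\ell+1)$ with rows and columns indexed by $0,\dots,\ell$; $E_{ij}$ is the matrix with $(i,j)$ entry $1$ and all other entries $0$; terms with an index outside $\{0,\dots,\ell\}$ (whose coefficients vanish) are zero. $\mathbb N=\{1,2,\dots\}$; $\binom{x}{m}=x(x-1)\cdots(x-m+1)/m!$ for real $x$ and $m\in\mathbb N_0$. $A^*$ is the conjugate transpose and $P^*(u)=P(u)^*$ for real $u$. Differential operators act on matrix valued functions with coefficients multiplying on the left. For matrix valued polynomials $P,Q$ put $(P,Q)=\int_0^1P(u)W(u)Q^*(u)\,du$ and $\langle P,Q\rangle=(P^*,Q^* )^*=\int_0^1Q^*(u)W(u)P(u)\,du$. A differential operator $E$ is symmetric with respect to $W$ if $\langle EP,Q\rangle=\langle P,EQ\rangle$ for all $(\ell+1)\times(\ell+1)$ matrix valued polynomials $P,Q$. *)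

theory Defs
  imports
    "HOL-Analysis.Analysis"
    "Jordan_Normal_Form.Schur_Decomposition"
begin

section \<open>Matrix valued polynomials, inner product and symmetry\<close>

text \<open>Matrices are those of \<open>Jordan_Normal_Form.Matrix\<close>, whose indices start at 0; an
  \<open>(\<ell>+1) \<times> (\<ell>+1)\<close> matrix is therefore indexed by \<open>0, \<dots>, \<ell>\<close>. This type carries no topology, so
  derivatives and integrals of matrix valued functions are taken entrywise.\<close>

definition mat_polynomial :: "nat \<Rightarrow> (real \<Rightarrow> complex mat) \<Rightarrow> bool" where
  "mat_polynomial n P \<longleftrightarrow>
    (\<exists>p :: complex poly mat. p \<in> carrier_mat n n \<and>
      (\<forall>u. P u = map_mat (\<lambda>q. poly q (complex_of_real u)) p))"

definition mat_deriv :: "(real \<Rightarrow> complex mat) \<Rightarrow> real \<Rightarrow> complex mat" where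
  "mat_deriv F u = Matrix.mat (dim_row (F u)) (dim_col (F u))
     (\<lambda>(i, j). vector_derivative (\<lambda>t. F t $$ (i, j)) (at u))"

definition mat_integral :: "nat \<Rightarrow> (real \<Rightarrow> complex mat) \<Rightarrow> complex mat" where
  "mat_integral n F = Matrix.mat n n
     (\<lambda>(i, j). set_lebesgue_integral lborel {0<..<1} (\<lambda>u. F u $$ (i, j)))"

definition mat_inner ::
  "nat \<Rightarrow> (real \<Rightarrow> complex mat) \<Rightarrow> (real \<Rightarrow> complex mat) \<Rightarrow> (real \<Rightarrow> complex mat) \<Rightarrow> complex mat" where
  "mat_inner n W P Q = mat_integral n (\<lambda>u. mat_adjoint (Q u) * W u * P u)"

definition symmetric_wrt ::
  "nat \<Rightarrow> (real \<Rightarrow> complex mat) \<Rightarrow> ((real \<Rightarrow> complex mat) \<Rightarrow> real \<Rightarrow> complex mat) \<Rightarrow> bool" where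
  "symmetric_wrt n W D \<longleftrightarrow>
    (\<forall>P Q. mat_polynomial n P \<longrightarrow> mat_polynomial n Q \<longrightarrow>
       mat_inner n W (D P) Q = mat_inner n W P (D Q))"


section \<open>The differential operator\<close>

text \<open>Sums \<open>\<Sum>\<^sub>i c\<^sub>i E\<^sub>i\<^sub>i\<close>, \<open>\<Sum>\<^sub>i c\<^sub>i E\<^sub>i\<^sub>,\<^sub>i\<^sub>-\<^sub>1\<close> and \<open>\<Sum>\<^sub>i c\<^sub>i E\<^sub>i\<^sub>,\<^sub>i\<^sub>+\<^sub>1\<close> are written through their entries: row \<open>i\<close>
  contributes \<open>c\<^sub>i\<close> in column \<open>j\<close> with \<open>j = i\<close>, \<open>j + 1 = i\<close> and \<open>j = i + 1\<close>, respectively. Terms with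
  an index outside \<open>0, \<dots>, \<ell>\<close> thus disappear.\<close>

definition Q0_mat :: "nat \<Rightarrow> complex mat" where
  "Q0_mat l = Matrix.mat (l + 1) (l + 1) (\<lambda>(i, j).
     if j + 1 = i then complex_of_real (3 * real i) else 0)"

definition Q1_mat :: "real \<Rightarrow> nat \<Rightarrow> complex mat" where
  "Q1_mat \<alpha> l = Matrix.mat (l + 1) (l + 1) (\<lambda>(i, j).
     if j = i then complex_of_real (\<alpha> - real l + 3 * real i) else 0)"

definition P0_mat :: "real \<Rightarrow> real \<Rightarrow> real \<Rightarrow> nat \<Rightarrow> complex mat" where
  "P0_mat \<alpha> \<beta> k l = Matrix.mat (l + 1) (l + 1) (\<lambda>(i, j).
     if j = i then complex_of_real
       ((\<alpha> + 2 * real l) * (\<beta> + 1 + 2 * real i) - 3 * k * (real l - real i)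
         - 3 * real i * (\<beta> - k + real i))
     else if j + 1 = i then complex_of_real
       (- (real i * (3 * real i + 3 * \<beta> - 3 * k + 3 + real l + 2 * \<alpha>)))
     else 0)"

definition P1_mat :: "real \<Rightarrow> real \<Rightarrow> real \<Rightarrow> nat \<Rightarrow> complex mat" where
  "P1_mat \<alpha> \<beta> k l = Matrix.mat (l + 1) (l + 1) (\<lambda>(i, j).
     if j = i then complex_of_real
       (- ((\<alpha> - real l + 3 * real i) * (\<alpha> + \<beta> + real l + real i + 2)))
     else if j = i + 1 then complex_of_real
       (3 * (\<beta> - k + 1 + real i) * (real l - real i))
     else 0)"

definition V_mat :: "real \<Rightarrow> real \<Rightarrow> real \<Rightarrow> nat \<Rightarrow> complex mat" where
  "V_mat \<alpha> \<beta> k l = Matrix.mat (l + 1) (l + 1) (\<lambda>(i, j).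
     if j = i then complex_of_real (real i * (\<alpha> + \<beta> - k + 1 + real i))
     else if j = i + 1 then complex_of_real
       (- ((real l - real i) * (\<beta> - k + 1 + real i)))
     else 0)"

definition E_op ::
  "real \<Rightarrow> real \<Rightarrow> real \<Rightarrow> nat \<Rightarrow> (real \<Rightarrow> complex mat) \<Rightarrow> real \<Rightarrow> complex mat" where
  "E_op \<alpha> \<beta> k l F u =
     (complex_of_real (1 - u) \<cdot>\<^sub>m (Q0_mat l + complex_of_real u \<cdot>\<^sub>m Q1_mat \<alpha> l))
         * mat_deriv (mat_deriv F) u
     + (P0_mat \<alpha> \<beta> k l + complex_of_real u \<cdot>\<^sub>m P1_mat \<alpha> \<beta> k l) * mat_deriv F u
     - (complex_of_real (\<alpha> + 2 * real l + 3 * k) \<cdot>\<^sub>m V_mat \<alpha> \<beta> k l) * F u"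


section \<open>The weight\<close>

definition Z_mat :: "real \<Rightarrow> real \<Rightarrow> nat \<Rightarrow> real \<Rightarrow> complex mat" where
  "Z_mat \<beta> k l u = Matrix.mat (l + 1) (l + 1) (\<lambda>(i, j). complex_of_real
     (\<Sum>r = 0..l. real (r choose i) * real (r choose j)
        * ((real l + k - 1 - real r) gchoose (l - r)) * ((\<beta> - k + real r) gchoose r)
        * (1 - u) ^ (l - r) * u ^ (i + j)))"

definition W_mat :: "real \<Rightarrow> real \<Rightarrow> real \<Rightarrow> nat \<Rightarrow> real \<Rightarrow> complex mat" where
  "W_mat \<alpha> \<beta> k l u = complex_of_real ((1 - u) powr \<alpha> * u powr \<beta>) \<cdot>\<^sub>m Z_mat \<beta> k l u"

end

theory Submission
  imports Defs
begin

text \<open>The weight is diagonalised by a change of variables that keeps polynomials polynomial. Put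
  \<open>X\<^sub>r\<^sub>i(u) = (r choose i) u\<^sup>i\<close>. Then \<open>Z = X\<^sup>T D X\<close>, where \<open>D\<close> is diagonal with entries \<open>c\<^sub>r (1-u)\<^bsup>l-r\<^esup>\<close>
  and \<open>c\<^sub>r\<close> is the product of the two generalised binomial coefficients (\<open>sum_Z_entry\<close>). So for
  columns \<open>p\<close>, \<open>q\<close> and \<open>f = X p\<close>, \<open>g = X q\<close> the bilinear pairing of \<open>E p\<close> with \<open>q\<close> has the density
  \<open>\<Sum>\<^sub>r c\<^sub>r (1-u)\<^bsup>\<alpha>+l-r\<^esup> u\<^sup>\<beta> g\<^sub>r (X E p)\<^sub>r\<close>, and one has to express \<open>X E p\<close> through \<open>f\<close>.
  The sesquilinear pairing reduces to this one by conjugating the coefficients of \<open>q\<close>, as \<open>E\<close> is real.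

  Row \<open>r\<close> of \<open>X\<close> is the coefficient sequence of \<open>(1 + u x)\<^sup>r\<close>, and \<open>E\<close> was built from multiplication by
  \<open>x\<close> and differentiation in \<open>x\<close>. This makes the transformed operator very sparse: lemma
  \<open>conjugated_operator\<close> shows that \<open>(X E p)\<^sub>r\<close> is \<open>\<alpha> - l + 3 r\<close> times the Jacobi operator of the weight
  \<open>(1-u)\<^bsup>\<alpha>+l-r\<^esup> u\<^sup>\<beta>\<close> applied to \<open>f\<^sub>r\<close>, plus first order terms in \<open>f\<^sub>r\<^sub>+\<^sub>1\<close> and \<open>f\<^sub>r\<^sub>-\<^sub>1\<close>.

  The Jacobi operators are symmetric by Lagrange's identity. The recurrence for \<open>c\<^sub>r\<close>
  (\<open>weight_coeff_Suc\<close>) makes the coupling between \<open>r\<close> and \<open>r + 1\<close> formally symmetric too. Hence the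
  density of the difference of the two pairings is the derivative of
  \<open>(1-u)\<^bsup>\<alpha>+1\<^esup> u\<^bsup>\<beta>+1\<^esup> R\<close> with a polynomial \<open>R\<close> (\<open>skew_density_is_jacobi_div\<close>). This function vanishes at
  both end points, so the difference of the integrals is zero (\<open>integral_jacobi_div\<close>).\<close>

section \<open>Exact derivatives for the Jacobi weight\<close>

definition jacobi_weight :: "real \<Rightarrow> real \<Rightarrow> real \<Rightarrow> real" where
  "jacobi_weight a b u = (1 - u) powr a * u powr b"

text \<open>The Pearson operator of the Jacobi weight \<open>w\<^sub>a\<^sub>,\<^sub>b = (1-u)\<^sup>a u\<^sup>b\<close>: it is
  \<open>R \<mapsto> (u(1-u) w\<^sub>a\<^sub>,\<^sub>b R)' / w\<^sub>a\<^sub>,\<^sub>b\<close>, which maps polynomials to polynomials.\<close>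
definition jacobi_div :: "real \<Rightarrow> real \<Rightarrow> complex poly \<Rightarrow> complex poly" where
  "jacobi_div a b R =
     [:of_real (b + 1), - of_real (a + b + 2):] * R + [:0, 1, -1:] * pderiv R"

lemma jacobi_div_add: "jacobi_div a b (R + S) = jacobi_div a b R + jacobi_div a b S"
  by (simp only: jacobi_div_def pderiv_add distrib_left add_ac)

lemma jacobi_div_smult: "jacobi_div a b (Polynomial.smult c R) = Polynomial.smult c (jacobi_div a b R)"
  by (simp add: jacobi_div_def pderiv_smult smult_add_right)

lemma jacobi_div_0 [simp]: "jacobi_div a b 0 = 0"
  by (simp add: jacobi_div_def)

lemma jacobi_div_sum: "jacobi_div a b (\<Sum>r\<in>A. R r) = (\<Sum>r\<in>A. jacobi_div a b (R r))"
  by (induction A rule: infinite_finite_induct) (simp_all add: jacobi_div_add)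

lemma jacobi_weight_integrable:
  assumes "a > -1" "b > -1" and h: "continuous_on {0..1} (h :: real \<Rightarrow> complex)"
  shows "set_integrable lborel {0<..<1} (\<lambda>u. of_real (jacobi_weight a b u) * h u)"
proof -
  have "set_integrable lborel {0..1} (\<lambda>t. t powr (b + 1 - 1) * (1 - t) powr (a + 1 - 1))"
    using assms by (intro integrable_Beta) auto
  hence 1: "set_integrable lborel {0<..<1} (jacobi_weight a b)"
    by (rule set_integrable_subset[THEN set_integrable_cong[THEN iffD1, rotated -1]])
       (auto simp: jacobi_weight_def)
  have "bounded (h ` {0..1})"
    using h by (intro compact_imp_bounded compact_continuous_image) auto
  then obtain B where B: "\<forall>u\<in>{0..1}. norm (h u) \<le> B"
    unfolding bounded_iff by blast
  have 2: "set_integrable lborel {0<..<1} (\<lambda>u. B * jacobi_weight a b u)"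
    using 1 by (rule set_integrable_mult_right)
  have [measurable]: "set_borel_measurable borel {0<..<1} h"
    unfolding set_borel_measurable_def
    by (intro borel_measurable_continuous_on_indicator continuous_on_subset[OF h]) auto
  have m: "set_borel_measurable lborel {0<..<1} (\<lambda>u. of_real (jacobi_weight a b u) * h u)"
  proof -
    have "(\<lambda>u. of_real (jacobi_weight a b u) * (indicator {0<..<1} u *\<^sub>R h u)) \<in> borel_measurable borel"
      using \<open>set_borel_measurable borel {0<..<1} h\<close>
      unfolding set_borel_measurable_def jacobi_weight_def by measurable
    thus ?thesis
      unfolding set_borel_measurable_def by (simp add: mult_ac)
  qed
  show ?thesis
    using 2 m
  proof (rule set_integrable_bound)
    show "AE u in lborel. u \<in> {0<..<1} \<longrightarrow>
        norm (of_real (jacobi_weight a b u) * h u) \<le> norm (B * jacobi_weight a b u)"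
    proof (intro AE_I2 impI)
      fix u :: real assume u: "u \<in> {0<..<1}"
      have "norm (h u) \<le> \<bar>B\<bar>" using B[rule_format, of u] u
        by (simp only: atLeastAtMost_iff greaterThanLessThan_iff) linarith
      thus "norm (of_real (jacobi_weight a b u) * h u) \<le> norm (B * jacobi_weight a b u)"
        by (simp add: norm_mult abs_mult mult.commute[of "\<bar>jacobi_weight a b u\<bar>"] mult_right_mono)
    qed
  qed
qed

lemma jacobi_weight_tendsto_0:
  assumes "a > 0" "b > 0"
  shows "(jacobi_weight a b \<longlongrightarrow> 0) (at_right 0)"
    and "(jacobi_weight a b \<longlongrightarrow> 0) (at_left 1)"
proof -
  have "((\<lambda>u::real. u powr b) \<longlongrightarrow> 0) (at_right 0)"
    using tendsto_powr'[of "\<lambda>u. u" 0 "at_right 0" "\<lambda>_. b" b] assms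
    by (auto simp: eventually_at_filter)
  moreover have "((\<lambda>u::real. (1 - u) powr a) \<longlongrightarrow> 1) (at_right 0)"
    by (rule tendsto_eq_intros | simp)+
  ultimately show "(jacobi_weight a b \<longlongrightarrow> 0) (at_right 0)"
    unfolding jacobi_weight_def by (auto intro: tendsto_eq_intros)
  have "((\<lambda>u::real. (1 - u) powr a) \<longlongrightarrow> 0) (at_left 1)"
    using tendsto_powr'[of "\<lambda>u. 1 - u" 0 "at_left 1" "\<lambda>_. a" a] assms
    by (auto simp: eventually_at_filter intro!: tendsto_eq_intros)
  moreover have "((\<lambda>u::real. u powr b) \<longlongrightarrow> 1) (at_left 1)"
    by (rule tendsto_eq_intros | simp)+
  ultimately show "(jacobi_weight a b \<longlongrightarrow> 0) (at_left 1)"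
    unfolding jacobi_weight_def by (auto intro: tendsto_eq_intros)
qed

lemma poly_of_real_has_vector_derivative:
  "((\<lambda>u. poly p (complex_of_real u)) has_vector_derivative poly (pderiv p) (of_real u)) (at u within S)"
  by (rule has_vector_derivative_real_field[OF poly_DERIV])

lemma jacobi_weight_poly_deriv:
  assumes "0 < u" "u < 1"
  shows "((\<lambda>u. of_real (jacobi_weight (a + 1) (b + 1) u) * poly R (of_real u))
     has_vector_derivative of_real (jacobi_weight a b u) * poly (jacobi_div a b R) (of_real u)) (at u)"
proof -
  have p: "(1 - u) powr (a + 1) = (1 - u) * (1 - u) powr a" "u powr (b + 1) = u * u powr b"
    using assms by (simp_all add: powr_add)
  have "(jacobi_weight (a + 1) (b + 1) has_real_derivative
      jacobi_weight a b u * ((b + 1) * (1 - u) - (a + 1) * u)) (at u)"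
    unfolding jacobi_weight_def
    by (rule DERIV_cong[OF DERIV_mult[OF
          DERIV_fun_powr[of "\<lambda>u. 1 - u" "- 1" u "a + 1"] DERIV_fun_powr[of "\<lambda>u. u" 1 u "b + 1"]]])
       (use assms in \<open>auto intro!: derivative_eq_intros simp: p\<close>, simp add: ring_distribs mult_ac)
  hence w: "((\<lambda>u. complex_of_real (jacobi_weight (a + 1) (b + 1) u)) has_vector_derivative
      of_real (jacobi_weight a b u * ((b + 1) * (1 - u) - (a + 1) * u))) (at u)"
    by (intro has_vector_derivative_of_real)
       (simp add: has_real_derivative_iff_has_vector_derivative)
  have j: "jacobi_weight (a + 1) (b + 1) u = jacobi_weight a b u * u * (1 - u)"
    using p by (simp add: jacobi_weight_def)
  show ?thesis
    by (rule has_vector_derivative_eq_rhs[OF has_vector_derivative_mult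
          [OF w poly_of_real_has_vector_derivative]])
       (simp only: j, simp add: jacobi_div_def algebra_simps)
qed

text \<open>The integrand is the derivative of \<open>w R\<close> with the weight \<open>w\<close> of exponents \<open>a + 1\<close> and \<open>b + 1\<close>;
  both exponents are positive, so \<open>w R\<close> vanishes at \<open>0\<close> and at \<open>1\<close>.\<close>
lemma integral_jacobi_div:
  assumes "a > -1" "b > -1"
  shows "(LBINT u:{0<..<1}. of_real (jacobi_weight a b u) * poly (jacobi_div a b R) (of_real u)) = 0"
proof -
  let ?F = "\<lambda>u. of_real (jacobi_weight (a + 1) (b + 1) u) * poly R (of_real u)"
  let ?f = "\<lambda>u. of_real (jacobi_weight a b u) * poly (jacobi_div a b R) (complex_of_real u)"
  have e: "einterval 0 1 = {0<..<1::real}"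
    by (auto simp: einterval_def zero_ereal_def one_ereal_def)
  have c: "isCont (\<lambda>u. poly p (complex_of_real u)) x" for p x
    by (intro continuous_intros)
  have l0: "(?F \<longlongrightarrow> of_real 0 * poly R (of_real 0)) (at_right 0)"
    using assms c[where p = R and x = 0]
    by (intro tendsto_intros jacobi_weight_tendsto_0) (auto simp: isCont_def filterlim_at_split)
  have l1: "(?F \<longlongrightarrow> of_real 0 * poly R (of_real 1)) (at_left 1)"
    using assms c[where p = R and x = 1]
    by (intro tendsto_intros jacobi_weight_tendsto_0) (auto simp: isCont_def filterlim_at_split)
  have "(LBINT u=0..1. ?f u) = 0 - 0"
  proof (rule interval_integral_FTC_integrable[where F = ?F])
    show "set_integrable lborel (einterval 0 1) ?f"
      unfolding e using assms by (intro jacobi_weight_integrable continuous_intros)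
    show "((?F \<circ> real_of_ereal) \<longlongrightarrow> 0) (at_right 0)"
      using l0 by (simp add: zero_ereal_def ereal_tendsto_simps)
    show "((?F \<circ> real_of_ereal) \<longlongrightarrow> 0) (at_left 1)"
      using l1 by (simp add: one_ereal_def ereal_tendsto_simps)
  next
    fix x :: real assume "0 < ereal x" "ereal x < 1"
    hence x: "0 < x" "x < 1" by (simp_all add: zero_ereal_def one_ereal_def)
    show "(?F has_vector_derivative ?f x) (at x)"
      by (rule jacobi_weight_poly_deriv[OF x])
    show "isCont ?f x"
      unfolding jacobi_weight_def using x by (intro continuous_intros) auto
  qed simp
  thus ?thesis
    by (simp add: interval_lebesgue_integral_def e)
qed

text \<open>A factor \<open>(1-u)\<^sup>N\<close> can be absorbed by the weight: it only raises the exponent \<open>a\<close> by \<open>N\<close>.\<close>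
lemma poly_jacobi_div_power:
  "poly (jacobi_div a b ([:1, -1:] ^ N * y)) z =
     (1 - z) ^ N * ((of_real (b + 1) - of_real (a + b + 2 + N) * z) * poly y z
        + z * (1 - z) * poly (pderiv y) z)"
proof -
  have "(1 - z) * poly (pderiv ([:1, -1:] ^ N)) z = - of_nat N * (1 - z) ^ N"
    unfolding pderiv_power by (cases N) (simp_all add: pderiv_pCons poly_power algebra_simps)
  hence "z * ((1 - z) * poly (pderiv ([:1, -1:] ^ N)) z) * poly y z = z * (- of_nat N * (1 - z) ^ N) * poly y z"
    by simp
  thus ?thesis
    by (simp add: jacobi_div_def pderiv_mult poly_power) (simp add: algebra_simps)
qed

text \<open>When \<open>y\<close> is divisible by \<open>u\<close>, the factor \<open>u\<close> of \<open>u(1-u)\<close> need not come from the weight: what is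
  differentiated is then \<open>(1-u)\<^bsup>a+1+N\<^esup> u\<^sup>b y\<close>, whose boundary term at \<open>0\<close> still disappears.\<close>
lemma poly_jacobi_div_power_quotient:
  assumes y: "y = [:0, 1:] * x" and "z \<noteq> 0"
  shows "poly (jacobi_div a b ([:1, -1:] ^ N * x)) z =
     (1 - z) ^ N * ((1 - z) * poly (pderiv y) z
        + (of_real b * (1 - z) / z - of_real (a + 1 + N)) * poly y z)"
proof -
  have "poly y z = z * poly x z" "poly (pderiv y) z = poly x z + z * poly (pderiv x) z"
    by (simp_all add: y pderiv_mult pderiv_pCons)
  thus ?thesis unfolding poly_jacobi_div_power
    using \<open>z \<noteq> 0\<close> by (simp add: field_simps)
qed

section \<open>Coefficients of the operator in the binomial basis\<close>

definition tridiag :: "(nat \<Rightarrow> real) \<Rightarrow> (nat \<Rightarrow> real) \<Rightarrow> (nat \<Rightarrow> real) \<Rightarrow> nat \<Rightarrow> nat \<Rightarrow> real" where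
  "tridiag d s t i j = (if j = i then d i else if j + 1 = i then s i else if j = i + 1 then t i else 0)"

lemma sum_mult_tridiag:
  assumes "j \<le> l" "x (Suc l) = 0"
  shows "(\<Sum>i\<le>l. x i * tridiag d s t i j) =
    x j * d j + x (Suc j) * s (Suc j) + (if j = 0 then 0 else x (j - 1) * t (j - 1))"
proof -
  have "(\<Sum>i\<le>l. x i * tridiag d s t i j) =
      (\<Sum>i\<le>l. (if i = j then x i * d i else 0) + (if i = Suc j then x i * s i else 0)
        + (if Suc i = j then x i * t i else 0))"
    by (intro sum.cong) (auto simp: tridiag_def)
  moreover have "(\<Sum>i\<le>l. if i = Suc j then x i * s i else 0) = x (Suc j) * s (Suc j)"
    using assms by (cases "j = l") (auto simp: sum.delta)
  moreover have "(\<Sum>i\<le>l. if Suc i = j then x i * t i else 0) = (if j = 0 then 0 else x (j - 1) * t (j - 1))"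
    using assms by (cases j) (auto simp: sum.delta)
  ultimately show ?thesis
    using assms by (simp add: sum.distrib)
qed

text \<open>The digit is the order of the derivative that the coefficient multiplies. The values are real, so
  that complex conjugation passes through \<open>E\<close>.\<close>
definition E2_entry :: "real \<Rightarrow> nat \<Rightarrow> real \<Rightarrow> nat \<Rightarrow> nat \<Rightarrow> real" where
  "E2_entry \<alpha> l u = tridiag (\<lambda>i. (1 - u) * (u * (\<alpha> - l + 3 * i))) (\<lambda>i. (1 - u) * (3 * i)) (\<lambda>i. 0)"

definition E1_entry :: "real \<Rightarrow> real \<Rightarrow> real \<Rightarrow> nat \<Rightarrow> real \<Rightarrow> nat \<Rightarrow> nat \<Rightarrow> real" where
  "E1_entry \<alpha> \<beta> k l u = tridiag
     (\<lambda>i. (\<alpha> + 2 * l) * (\<beta> + 1 + 2 * i) - 3 * k * (real l - i) - 3 * i * (\<beta> - k + i)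
        - u * ((\<alpha> - l + 3 * i) * (\<alpha> + \<beta> + l + i + 2)))
     (\<lambda>i. - (i * (3 * i + 3 * \<beta> - 3 * k + 3 + l + 2 * \<alpha>)))
     (\<lambda>i. u * (3 * (\<beta> - k + 1 + i) * (real l - i)))"

definition E0_entry :: "real \<Rightarrow> real \<Rightarrow> real \<Rightarrow> nat \<Rightarrow> nat \<Rightarrow> nat \<Rightarrow> real" where
  "E0_entry \<alpha> \<beta> k l = tridiag
     (\<lambda>i. - (\<alpha> + 2 * real l + 3 * k) * (i * (\<alpha> + \<beta> - k + 1 + i)))
     (\<lambda>i. 0)
     (\<lambda>i. (\<alpha> + 2 * real l + 3 * k) * ((real l - i) * (\<beta> - k + 1 + i)))"

text \<open>The matrix \<open>X(u)\<close> with these entries satisfies \<open>Z = X\<^sup>T D X\<close> with a diagonal matrix \<open>D\<close>. Row \<open>r\<close>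
  consists of the coefficients of \<open>(1 + u x)\<^sup>r\<close> as a polynomial in \<open>x\<close>.\<close>
definition binomial_entry :: "nat \<Rightarrow> real \<Rightarrow> nat \<Rightarrow> real" where
  "binomial_entry r u i = real (r choose i) * u ^ i"

lemma choose_Suc_real: "(real m + 1) * real (r choose Suc m) = (real r - real m) * real (r choose m)"
proof (cases "m \<le> r")
  case True
  have "Suc m * (r choose Suc m) = (r choose m) * (r - m)"
    by (metis Suc_times_binomial_eq binomial_absorb_comp binomial_absorption mult.commute
        choose_mult_lemma)
  hence "real (Suc m * (r choose Suc m)) = real ((r choose m) * (r - m))" by simp
  thus ?thesis using True by (simp add: of_nat_diff algebra_simps)
next
  case False thus ?thesis by (simp add: binomial_eq_0)
qed

lemma choose_pred_real: "real r * real ((r - 1) choose m) = (real r - real m) * real (r choose m)"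
proof (cases r)
  case (Suc r')
  show ?thesis
  proof (cases "m \<le> r'")
    case True
    have "(Suc r' - m) * (Suc r' choose m) = Suc r' * (r' choose m)"
      using binomial_absorb_comp[of "Suc r'" m] by simp
    hence "real ((Suc r' - m) * (Suc r' choose m)) = real (Suc r' * (r' choose m))" by simp
    thus ?thesis using True Suc unfolding of_nat_mult by (simp add: of_nat_diff)
  next
    case False thus ?thesis using Suc by (cases "m = Suc r'") (auto simp: binomial_eq_0)
  qed
qed (cases m; simp)

text \<open>The next three lemmas multiply the coefficients of \<open>E\<close> from the left by row \<open>r\<close> of \<open>X\<close>. On
  coefficient sequences of polynomials in \<open>x\<close>, the leading coefficient acts as
  \<open>(1-u)(3 d/dx + u(\<alpha> - l + 3 x d/dx))\<close>, of which \<open>(1 + u x)\<^sup>r\<close> is an eigenvector.\<close>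
lemma sum_binomial_E2:
  assumes "r \<le> l" "j \<le> l"
  shows "(\<Sum>i\<le>l. binomial_entry r u i * E2_entry \<alpha> l u i j) =
    (\<alpha> - real l + 3 * real r) * (u * (1 - u)) * binomial_entry r u j"
proof -
  have 0: "binomial_entry r u (Suc l) = 0" using assms by (simp add: binomial_entry_def binomial_eq_0)
  define B D U where BDU: "B = real (r choose j)" "D = real (r choose Suc j)" "U = u ^ j"
  have BD: "(real j + 1) * D = (real r - real j) * B"
    unfolding BDU by (rule choose_Suc_real)
  show ?thesis
    unfolding E2_entry_def sum_mult_tridiag[where x = "binomial_entry r u" and j = j and l = l, OF assms(2) 0]
    using BD
    by (simp only: binomial_entry_def power_Suc BDU[symmetric] of_nat_Suc of_nat_mult of_nat_numeral
          mult_zero_right if_cancel) Groebner_Basis.algebra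
qed

text \<open>A second order operator in \<open>x\<close> applied to \<open>(1 + u x)\<^sup>r\<close> involves the powers \<open>r + 1, \<dots>, r - 2\<close>. The
  coefficients of the power \<open>r - 2\<close> cancel. What is left in the diagonal part makes
  the factor of \<open>\<alpha> - l + 3 r\<close> the first order part of a Jacobi operator; the term with
  \<open>j / u\<close> is the cross term in the second derivative of \<open>u\<^sup>j p\<^sub>j\<close>.\<close>
lemma sum_binomial_E1:
  assumes "r \<le> l" "j \<le> l" "u \<noteq> 0"
  shows "(\<Sum>i\<le>l. binomial_entry r u i * E1_entry \<alpha> \<beta> k l u i j) =
    (\<alpha> - real l + 3 * real r) * (u * (1 - u) * 2 * (real j * binomial_entry r u j / u)
       + (\<beta> + 1 - (\<alpha> + \<beta> + 2 + (real l - real r)) * u) * binomial_entry r u j)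
    + 3 * (\<beta> - k + 1 + real r) * (real l - real r) * binomial_entry (r + 1) u j
    - 3 * real r * (real l + k - real r) * (1 - u) * binomial_entry (r - 1) u j"
proof -
  have 0: "binomial_entry r u (Suc l) = 0" using assms by (simp add: binomial_entry_def binomial_eq_0)
  note S = sum_mult_tridiag[where x = "binomial_entry r u" and j = j and l = l, OF assms(2) 0]
  show ?thesis
  proof (cases j)
    case 0
    have "real r * real (r - 1 choose 0) = real r" by simp
    then show ?thesis unfolding E1_entry_def S
      by (simp add: 0 binomial_entry_def algebra_simps)
  next
    case (Suc m)
    note S' = S[unfolded Suc diff_Suc_1]
    \<comment> \<open>By the recurrences for binomial coefficients everything is a combination of \<open>A\<close> and \<open>B\<close>,
      which satisfy one linear relation.\<close>
    define A B D F where ABDF: "A = real (r choose m)" "B = real (r choose Suc m)"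
      "D = real (r choose Suc (Suc m))" "F = real (r - 1 choose Suc m)"
    have AB: "(real m + 1) * B = (real r - real m) * A"
      and BD: "(real m + 2) * D = (real r - real m - 1) * B"
      and F: "real r * F = (real r - real m - 1) * B"
      unfolding ABDF using choose_Suc_real[of m r] choose_Suc_real[of "Suc m" r] choose_pred_real[of r "Suc m"]
      by (simp_all add: algebra_simps)
    have X: "binomial_entry r u m = A * u ^ m" "binomial_entry r u (Suc m) = B * (u * u ^ m)"
        "binomial_entry r u (Suc (Suc m)) = D * (u * (u * u ^ m))"
        "binomial_entry (r - 1) u (Suc m) = F * (u * u ^ m)"
        "binomial_entry (r + 1) u (Suc m) = (A + B) * (u * u ^ m)"
      by (simp_all add: binomial_entry_def ABDF)
    define U where "U = u ^ m"
    have d: "real (Suc m) * (B * (u * U)) / u = (real m + 1) * B * U"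
      using assms by simp
    show ?thesis unfolding E1_entry_def Suc S' X U_def[symmetric] d
      using AB BD F by (simp only: nat.distinct if_False of_nat_Suc of_nat_add of_nat_mult of_nat_numeral of_nat_1) Groebner_Basis.algebra
  qed
qed

text \<open>The right-hand side is grouped by the factors with which derivatives of \<open>u\<^sup>j\<close> contribute to
  the second order, the forward and the backward part of the transformed operator. The
  remaining zero order terms are differences of adjacent rows, because for \<open>j = 0\<close>
  the left-hand side vanishes, so that constants in the first component are killed.\<close>
lemma sum_binomial_E0:
  assumes "r \<le> l" "j \<le> l" "u \<noteq> 0"
  shows "(\<Sum>i\<le>l. binomial_entry r u i * E0_entry \<alpha> \<beta> k l i j) =
    (\<alpha> - real l + 3 * real r) * (u * (1 - u) * (real j * (real j - 1) * binomial_entry r u j / u\<^sup>2)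
       + (\<beta> + 1 - (\<alpha> + \<beta> + 2 + (real l - real r)) * u) * (real j * binomial_entry r u j / u))
    + 3 * (\<beta> - k + 1 + real r) * (real l - real r) * (real j * binomial_entry (r + 1) u j / u
        + ((\<alpha> + 2 * real l + 3 * k) / 3 - (real r + 1)) / u * (binomial_entry (r + 1) u j - binomial_entry r u j))
    - 3 * real r * (real l + k - real r) * ((1 - u) * (real j * binomial_entry (r - 1) u j / u)
        + (\<beta> * (1 - u) / u - (\<alpha> + real l - real r + 1) - (1 - u) * (((\<alpha> + 2 * real l + 3 * k) / 3 - real r) / u))
          * (binomial_entry (r - 1) u j - binomial_entry r u j))"
proof -
  have 0: "binomial_entry r u (Suc l) = 0" using assms by (simp add: binomial_entry_def binomial_eq_0)
  note S = sum_mult_tridiag[where x = "binomial_entry r u" and j = j and l = l, OF assms(2) 0]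
  show ?thesis
  proof (cases j)
    case 0
    then show ?thesis unfolding E0_entry_def S
      by (simp add: 0 binomial_entry_def)
  next
    case (Suc m)
    note S' = S[unfolded Suc diff_Suc_1]
    define A B F where ABDF: "A = real (r choose m)" "B = real (r choose Suc m)"
      "F = real (r - 1 choose Suc m)"
    have AB: "(real m + 1) * B = (real r - real m) * A"
      and F: "real r * F = (real r - real m - 1) * B"
      unfolding ABDF using choose_Suc_real[of m r] choose_pred_real[of r "Suc m"]
      by (simp_all add: algebra_simps)
    have X: "binomial_entry r u m = A * u ^ m" "binomial_entry r u (Suc m) = B * (u * u ^ m)"
        "binomial_entry (r - 1) u (Suc m) = F * (u * u ^ m)"
        "binomial_entry (r + 1) u (Suc m) = (A + B) * (u * u ^ m)"
      by (simp_all add: binomial_entry_def ABDF)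
    define U where "U = u ^ m"
    \<comment> \<open>With the inverse as a variable subject to \<open>u * v = 1\<close> this is a polynomial identity.\<close>
    define v where "v = 1 / u"
    have uv: "u * v = 1" "x / u = x * v" "x / u\<^sup>2 = x * v * v" for x
      using assms by (simp_all add: v_def power2_eq_square)
    show ?thesis unfolding E0_entry_def Suc S' X U_def[symmetric] uv(2-)
      using AB F uv(1) by (simp only: nat.distinct if_False of_nat_Suc of_nat_add of_nat_mult of_nat_numeral of_nat_1) Groebner_Basis.algebra
  qed
qed

section \<open>The transformed operator\<close>

text \<open>For a column \<open>p\<close> of polynomials this is the component \<open>f\<^sub>r\<close> of \<open>f = X p\<close>, as a polynomial in \<open>u\<close>.\<close>
definition binomial_comb :: "nat \<Rightarrow> (nat \<Rightarrow> complex poly) \<Rightarrow> nat \<Rightarrow> complex poly" where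
  "binomial_comb l p r = (\<Sum>j\<le>l. Polynomial.smult (of_nat (r choose j)) (Polynomial.monom 1 j * p j))"

text \<open>Coefficients multiply on the left, so \<open>E\<close> acts on each column of a matrix separately.\<close>
definition E_vec :: "real \<Rightarrow> real \<Rightarrow> real \<Rightarrow> nat \<Rightarrow> (nat \<Rightarrow> complex poly) \<Rightarrow> real \<Rightarrow> nat \<Rightarrow> complex" where
  "E_vec \<alpha> \<beta> k l p u i = (\<Sum>j\<le>l.
       of_real (E2_entry \<alpha> l u i j) * poly (pderiv (pderiv (p j))) (of_real u)
     + of_real (E1_entry \<alpha> \<beta> k l u i j) * poly (pderiv (p j)) (of_real u)
     + of_real (E0_entry \<alpha> \<beta> k l i j) * poly (p j) (of_real u))"

lemma poly_binomial_comb: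
  "poly (binomial_comb l p r) (of_real u) = (\<Sum>j\<le>l. of_real (binomial_entry r u j) * poly (p j) (of_real u))"
  by (simp add: binomial_comb_def binomial_entry_def poly_sum poly_monom mult_ac)

lemma poly_pderiv_monom_1:
  assumes "z \<noteq> 0"
  shows "poly (pderiv (Polynomial.monom 1 j)) z = (of_nat j * z ^ j / z :: complex)"
  using assms by (cases j) (simp_all add: pderiv_monom poly_monom)

lemma poly_pderiv_pderiv_monom_1:
  assumes "z \<noteq> 0"
  shows "poly (pderiv (pderiv (Polynomial.monom 1 j))) z = (of_nat j * (of_nat j - 1) * z ^ j / z\<^sup>2 :: complex)"
proof (cases j)
  case (Suc m)
  thus ?thesis using assms
    by (cases m) (simp_all add: pderiv_monom poly_monom power2_eq_square)
qed (simp add: pderiv_monom)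

lemma poly_pderiv_binomial_comb:
  assumes "u \<noteq> 0"
  shows "poly (pderiv (binomial_comb l p r)) (of_real u) =
    (\<Sum>j\<le>l. of_real (binomial_entry r u j) * poly (pderiv (p j)) (of_real u)
       + of_real (real j * binomial_entry r u j / u) * poly (p j) (of_real u))"
  unfolding binomial_comb_def binomial_entry_def pderiv_sum poly_sum
  using assms
  by (intro sum.cong) (simp_all add: pderiv_smult pderiv_mult poly_pderiv_monom_1 poly_monom algebra_simps)

lemma poly_pderiv_pderiv_binomial_comb:
  assumes "u \<noteq> 0"
  shows "poly (pderiv (pderiv (binomial_comb l p r))) (of_real u) =
    (\<Sum>j\<le>l. of_real (binomial_entry r u j) * poly (pderiv (pderiv (p j))) (of_real u)
       + of_real (2 * (real j * binomial_entry r u j / u)) * poly (pderiv (p j)) (of_real u)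
       + of_real (real j * (real j - 1) * binomial_entry r u j / u\<^sup>2) * poly (p j) (of_real u))"
  unfolding binomial_comb_def binomial_entry_def pderiv_sum poly_sum
  using assms
  by (intro sum.cong)
     (simp_all add: pderiv_smult pderiv_mult pderiv_add poly_pderiv_monom_1 poly_pderiv_pderiv_monom_1 poly_monom algebra_simps)

text \<open>The operator \<open>X E X\<^sup>-\<^sup>1\<close>. On the diagonal there are multiples of Jacobi operators; the coupling to
  the neighbours \<open>f\<^sub>r\<^sub>+\<^sub>1\<close> and \<open>f\<^sub>r\<^sub>-\<^sub>1\<close> is of first order only. The factor of the backward coupling is zero for
  \<open>r = 0\<close> and that of the forward coupling for \<open>r = l\<close>, where there is no such neighbour.\<close>
lemma conjugated_operator:
  fixes p :: "nat \<Rightarrow> complex poly" and \<alpha> \<beta> k u :: real and l r :: nat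
  assumes "r \<le> l" "u \<noteq> 0"
  defines "f \<equiv> \<lambda>r. poly (binomial_comb l p r) (of_real u)"
    and "f' \<equiv> \<lambda>r. poly (pderiv (binomial_comb l p r)) (of_real u)"
    and "f'' \<equiv> \<lambda>r. poly (pderiv (pderiv (binomial_comb l p r))) (of_real u)"
  shows "(\<Sum>i\<le>l. of_real (binomial_entry r u i) * E_vec \<alpha> \<beta> k l p u i) =
    of_real (\<alpha> - real l + 3 * real r) * (of_real (u * (1 - u)) * f'' r
       + of_real (\<beta> + 1 - (\<alpha> + \<beta> + 2 + (real l - real r)) * u) * f' r)
    + of_real (3 * (\<beta> - k + 1 + real r) * (real l - real r)) * (f' (r + 1)
        + of_real (((\<alpha> + 2 * real l + 3 * k) / 3 - (real r + 1)) / u) * (f (r + 1) - f r))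
    - of_real (3 * real r * (real l + k - real r)) * (of_real (1 - u) * f' (r - 1)
        + of_real (\<beta> * (1 - u) / u - (\<alpha> + real l - real r + 1) - (1 - u) * (((\<alpha> + 2 * real l + 3 * k) / 3 - real r) / u))
          * (f (r - 1) - f r))"
    (is "?lhs = of_real ?lam * (of_real ?s * _ + of_real ?J * _) + of_real ?b * (_ + of_real ?xi * _)
           - of_real ?n * (of_real ?t * _ + of_real ?ze * _)")
proof -
  define q0 q1 q2 where "q0 j = poly (p j) (of_real u)" "q1 j = poly (pderiv (p j)) (of_real u)"
    "q2 j = poly (pderiv (pderiv (p j))) (of_real u)" for j
  have combine: "of_real S2 * q2 j + of_real S1 * q1 j + of_real S0 * q0 j =
      of_real lam * (of_real s * (of_real c * q2 j + of_real (2 * d) * q1 j + of_real e * q0 j)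
          + of_real J * (of_real c * q1 j + of_real d * q0 j))
        + of_real b * ((of_real c' * q1 j + of_real d' * q0 j) + of_real x * (of_real c' * q0 j - of_real c * q0 j))
        - of_real n * (of_real t * (of_real c'' * q1 j + of_real d'' * q0 j) + of_real y * (of_real c'' * q0 j - of_real c * q0 j))"
    if "S2 = lam * s * c" "S1 = lam * (s * 2 * d + J * c) + b * c' - n * t * c''"
      "S0 = lam * (s * e + J * d) + b * (d' + x * (c' - c)) - n * (t * d'' + y * (c'' - c))"
    for S0 S1 S2 lam s J b n t x y c d e c' d' c'' d'' :: real and j
    unfolding that by (simp add: algebra_simps)
  have "?lhs = (\<Sum>i\<le>l. \<Sum>j\<le>l. of_real (binomial_entry r u i) *
       (of_real (E2_entry \<alpha> l u i j) * q2 j + of_real (E1_entry \<alpha> \<beta> k l u i j) * q1 j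
        + of_real (E0_entry \<alpha> \<beta> k l i j) * q0 j))"
    by (simp only: E_vec_def sum_distrib_left q0_q1_q2_def)
  also have "\<dots> = (\<Sum>j\<le>l. \<Sum>i\<le>l. of_real (binomial_entry r u i) *
       (of_real (E2_entry \<alpha> l u i j) * q2 j + of_real (E1_entry \<alpha> \<beta> k l u i j) * q1 j
        + of_real (E0_entry \<alpha> \<beta> k l i j) * q0 j))"
    by (rule sum.swap)
  also have "\<dots> = (\<Sum>j\<le>l. of_real (\<Sum>i\<le>l. binomial_entry r u i * E2_entry \<alpha> l u i j) * q2 j
       + of_real (\<Sum>i\<le>l. binomial_entry r u i * E1_entry \<alpha> \<beta> k l u i j) * q1 j
       + of_real (\<Sum>i\<le>l. binomial_entry r u i * E0_entry \<alpha> \<beta> k l i j) * q0 j)"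
    by (simp add: sum_distrib_right sum.distrib distrib_left mult.assoc)
  also have "\<dots> = (\<Sum>j\<le>l.
      of_real ?lam * (of_real ?s * (of_real (binomial_entry r u j) * q2 j
            + of_real (2 * (real j * binomial_entry r u j / u)) * q1 j
            + of_real (real j * (real j - 1) * binomial_entry r u j / u\<^sup>2) * q0 j)
        + of_real ?J * (of_real (binomial_entry r u j) * q1 j + of_real (real j * binomial_entry r u j / u) * q0 j))
      + of_real ?b * ((of_real (binomial_entry (r + 1) u j) * q1 j + of_real (real j * binomial_entry (r + 1) u j / u) * q0 j)
        + of_real ?xi * (of_real (binomial_entry (r + 1) u j) * q0 j - of_real (binomial_entry r u j) * q0 j))
      - of_real ?n * (of_real ?t * (of_real (binomial_entry (r - 1) u j) * q1 j + of_real (real j * binomial_entry (r - 1) u j / u) * q0 j)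
        + of_real ?ze * (of_real (binomial_entry (r - 1) u j) * q0 j - of_real (binomial_entry r u j) * q0 j)))"
  proof (intro sum.cong refl)
    fix j assume "j \<in> {..l}"
    hence j: "j \<le> l" by simp
    show "of_real (\<Sum>i\<le>l. binomial_entry r u i * E2_entry \<alpha> l u i j) * q2 j
       + of_real (\<Sum>i\<le>l. binomial_entry r u i * E1_entry \<alpha> \<beta> k l u i j) * q1 j
       + of_real (\<Sum>i\<le>l. binomial_entry r u i * E0_entry \<alpha> \<beta> k l i j) * q0 j =
      of_real ?lam * (of_real ?s * (of_real (binomial_entry r u j) * q2 j
            + of_real (2 * (real j * binomial_entry r u j / u)) * q1 j
            + of_real (real j * (real j - 1) * binomial_entry r u j / u\<^sup>2) * q0 j)
        + of_real ?J * (of_real (binomial_entry r u j) * q1 j + of_real (real j * binomial_entry r u j / u) * q0 j))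
      + of_real ?b * ((of_real (binomial_entry (r + 1) u j) * q1 j + of_real (real j * binomial_entry (r + 1) u j / u) * q0 j)
        + of_real ?xi * (of_real (binomial_entry (r + 1) u j) * q0 j - of_real (binomial_entry r u j) * q0 j))
      - of_real ?n * (of_real ?t * (of_real (binomial_entry (r - 1) u j) * q1 j + of_real (real j * binomial_entry (r - 1) u j / u) * q0 j)
        + of_real ?ze * (of_real (binomial_entry (r - 1) u j) * q0 j - of_real (binomial_entry r u j) * q0 j))"
      by (rule combine[OF sum_binomial_E2[OF assms(1) j] sum_binomial_E1[OF assms(1) j assms(2)]
            sum_binomial_E0[OF assms(1) j assms(2)]])
  qed
  also have "\<dots> = of_real ?lam * (of_real ?s * f'' r + of_real ?J * f' r) + of_real ?b * (f' (r + 1) + of_real ?xi * (f (r + 1) - f r))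
           - of_real ?n * (of_real ?t * f' (r - 1) + of_real ?ze * (f (r - 1) - f r))"
    unfolding f_def f'_def f''_def poly_binomial_comb poly_pderiv_binomial_comb[OF assms(2)]
      poly_pderiv_pderiv_binomial_comb[OF assms(2)] q0_q1_q2_def[symmetric]
    by (simp only: sum.distrib sum_subtractf sum_distrib_left[symmetric])
  finally show ?thesis .
qed

section \<open>The antiderivative of the skew density\<close>

text \<open>The constants of the diagonal matrix \<open>D\<close>, whose entries are these times \<open>(1-u)\<^bsup>l-r\<^esup>\<close>.\<close>
definition weight_coeff :: "real \<Rightarrow> real \<Rightarrow> nat \<Rightarrow> nat \<Rightarrow> real" where
  "weight_coeff \<beta> k l r = ((real l + k - 1 - real r) gchoose (l - r)) * ((\<beta> - k + real r) gchoose r)"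

text \<open>This balances the forward coupling in row \<open>r\<close> against the backward coupling in row \<open>r + 1\<close>, in
  the same way as a tridiagonal matrix is made symmetric by a diagonal one.\<close>
lemma weight_coeff_Suc:
  fixes \<beta> k :: real
  assumes "r < l"
  shows "weight_coeff \<beta> k l (Suc r) * (real (Suc r) * (real l + k - real (Suc r))) =
         weight_coeff \<beta> k l r * ((\<beta> - k + 1 + real r) * (real l - real r))"
proof -
  obtain m where m: "l - r = Suc m" "l - Suc r = m" "real l - real r = real (Suc m)"
    using assms by (intro that[of "l - Suc r"]) auto
  have 1: "real (Suc m) * ((real l + k - 1 - r) gchoose Suc m) =
      (real l + k - 1 - r) * ((real l + k - 1 - r - 1) gchoose m)"
    by (rule gbinomial_absorption)
  have 2: "real (Suc r) * ((\<beta> - k + Suc r) gchoose Suc r) =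
      (\<beta> - k + Suc r) * ((\<beta> - k + Suc r - 1) gchoose r)"
    by (rule gbinomial_absorption)
  have 3: "real l + k - 1 - r - 1 = real l + k - 1 - Suc r" "\<beta> - k + Suc r - 1 = \<beta> - k + r"
    by simp_all
  have "weight_coeff \<beta> k l (Suc r) * (real (Suc r) * (real l + k - real (Suc r))) =
      (real (Suc r) * ((\<beta> - k + Suc r) gchoose Suc r)) *
      ((real l + k - 1 - r) * ((real l + k - 1 - Suc r) gchoose m))"
    by (simp add: weight_coeff_def m mult_ac)
  also have "\<dots> = ((\<beta> - k + Suc r) * ((\<beta> - k + r) gchoose r)) *
      (real (Suc m) * ((real l + k - 1 - r) gchoose Suc m))"
    unfolding 1 2 3 ..
  also have "\<dots> = weight_coeff \<beta> k l r * ((\<beta> - k + 1 + real r) * (real l - real r))"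
    by (simp add: weight_coeff_def m mult_ac add_ac)
  finally show ?thesis .
qed

lemma poly_binomial_comb_0: "poly (binomial_comb l p r) 0 = poly (p 0) 0"
proof -
  have "poly (binomial_comb l p r) 0 = (\<Sum>j\<le>l. if j = 0 then poly (p 0) 0 else 0)"
    unfolding binomial_comb_def poly_sum
    by (intro sum.cong) (auto simp: poly_monom)
  thus ?thesis by simp
qed

text \<open>The core of the proof. Let \<open>f = X p\<close> and \<open>g = X q\<close>. The Jacobi operators on the diagonal contribute
  the divergence of the Wronskians \<open>g\<^sub>r f\<^sub>r' - f\<^sub>r g\<^sub>r'\<close> (Lagrange's identity). The forward coupling of row
  \<open>r\<close> and the backward coupling of row \<open>r + 1\<close> together contribute the derivative of a multiple of
  \<open>g\<^sub>r f\<^sub>r\<^sub>+\<^sub>1 - f\<^sub>r g\<^sub>r\<^sub>+\<^sub>1\<close>. The latter is divisible by \<open>u\<close>, since \<open>f\<^sub>r(0) = p\<^sub>0(0)\<close> for all \<open>r\<close>, and this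
  is the factor that makes the boundary term at \<open>0\<close> vanish.\<close>
lemma skew_density_is_jacobi_div:
  fixes p q :: "nat \<Rightarrow> complex poly" and \<alpha> \<beta> k :: real and l :: nat
  obtains R where "\<And>u. u \<noteq> 0 \<Longrightarrow>
    (\<Sum>r\<le>l. of_real (weight_coeff \<beta> k l r * (1 - u) ^ (l - r)) *
       (poly (binomial_comb l q r) (of_real u) * (\<Sum>i\<le>l. of_real (binomial_entry r u i) * E_vec \<alpha> \<beta> k l p u i)
      - poly (binomial_comb l p r) (of_real u) * (\<Sum>i\<le>l. of_real (binomial_entry r u i) * E_vec \<alpha> \<beta> k l q u i)))
    = poly (jacobi_div \<alpha> \<beta> R) (of_real u)"
proof -
  define f g where "f = binomial_comb l p" and "g = binomial_comb l q"
  define wronskian cross where "wronskian r = g r * pderiv (f r) - f r * pderiv (g r)"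
    and "cross r = g r * f (Suc r) - f r * g (Suc r)" for r
  have "poly (cross r) 0 = 0" for r
    by (simp add: cross_def f_def g_def poly_binomial_comb_0)
  hence "\<exists>h. cross r = [:0, 1:] * h" for r
    using poly_eq_0_iff_dvd[of "cross r" 0] by (auto elim: dvdE)
  \<comment> \<open>The contribution of a pair of neighbours to the antiderivative is \<open>h r\<close>, up to powers and constants.\<close>
  then obtain h where h: "\<And>r. cross r = [:0, 1:] * h r" by metis
  define lam where "lam r = \<alpha> - real l + 3 * real r" for r
  define kap where "kap r = weight_coeff \<beta> k l r * (3 * (\<beta> - k + 1 + real r) * (real l - real r))" for r
  have kap: "kap r = weight_coeff \<beta> k l (Suc r) * (3 * real (Suc r) * (real l + k - real (Suc r)))" if "r < l" for r
    using weight_coeff_Suc[OF that, of \<beta> k] unfolding kap_def by Groebner_Basis.algebra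
  define R where "R = (\<Sum>r\<le>l. Polynomial.smult (of_real (weight_coeff \<beta> k l r * lam r)) ([:1, -1:] ^ (l - r) * wronskian r))
     + (\<Sum>r<l. Polynomial.smult (of_real (kap r)) ([:1, -1:] ^ (l - Suc r) * h r))"
  show thesis
  proof (rule that[of R])
    fix u :: real assume u: "u \<noteq> 0"
    define z where "z = complex_of_real u"
    have z: "z \<noteq> 0" using u by (simp add: z_def)
    define J where "J r = \<beta> + 1 - (\<alpha> + \<beta> + 2 + (real l - real r)) * u" for r :: nat
    define xi where "xi r = ((\<alpha> + 2 * real l + 3 * k) / 3 - (real r + 1)) / u" for r :: nat
    define ze where "ze r = \<beta> * (1 - u) / u - (\<alpha> + real l - real r + 1) - (1 - u) * (((\<alpha> + 2 * real l + 3 * k) / 3 - real r) / u)" for r :: nat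
    define forward where "forward x r = poly (pderiv (x (Suc r))) z + of_real (xi r) * (poly (x (Suc r)) z - poly (x r) z)"
      for x :: "nat \<Rightarrow> complex poly" and r
    define backward where "backward x r = (1 - z) * poly (pderiv (x (r - 1))) z + of_real (ze r) * (poly (x (r - 1)) z - poly (x r) z)"
      for x :: "nat \<Rightarrow> complex poly" and r
    have transformed: "(\<Sum>i\<le>l. of_real (binomial_entry r u i) * E_vec \<alpha> \<beta> k l p u i) =
        of_real (lam r) * (z * (1 - z) * poly (pderiv (pderiv (binomial_comb l p r))) z
            + of_real (J r) * poly (pderiv (binomial_comb l p r)) z)
        + of_real (3 * (\<beta> - k + 1 + real r) * (real l - real r)) * forward (binomial_comb l p) r
        - of_real (3 * real r * (real l + k - real r)) * backward (binomial_comb l p) r" if "r \<le> l" for r and p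
      unfolding conjugated_operator[OF that u] lam_def J_def forward_def backward_def z_def xi_def ze_def
      by simp
    let ?S = "\<lambda>r. of_real (weight_coeff \<beta> k l r * (1 - u) ^ (l - r)) *
       (poly (g r) z * (\<Sum>i\<le>l. of_real (binomial_entry r u i) * E_vec \<alpha> \<beta> k l p u i)
      - poly (f r) z * (\<Sum>i\<le>l. of_real (binomial_entry r u i) * E_vec \<alpha> \<beta> k l q u i))"
    \<comment> \<open>The subtracted multiples of \<open>f r\<close> and \<open>g r\<close> inside \<open>forward\<close> and \<open>backward\<close> cancel by antisymmetry.\<close>
    let ?F = "\<lambda>r. poly (g r) z * forward f r - poly (f r) z * forward g r"
    let ?B = "\<lambda>r. poly (g r) z * backward f r - poly (f r) z * backward g r"
    have diag: "of_real (weight_coeff \<beta> k l r * lam r) * poly (jacobi_div \<alpha> \<beta> ([:1, -1:] ^ (l - r) * wronskian r)) z =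
        of_real (weight_coeff \<beta> k l r) * (1 - z) ^ (l - r) * of_real (lam r) *
        (poly (g r) z * (z * (1 - z) * poly (pderiv (pderiv (f r))) z + of_real (J r) * poly (pderiv (f r)) z)
       - poly (f r) z * (z * (1 - z) * poly (pderiv (pderiv (g r))) z + of_real (J r) * poly (pderiv (g r)) z))"
      if "r \<le> l" for r
    proof -
      have "of_real (J r) = of_real (\<beta> + 1) - of_real (\<alpha> + \<beta> + 2 + (l - r)) * z"
        using that by (simp add: J_def z_def of_nat_diff)
      moreover have "poly (wronskian r) z = poly (g r) z * poly (pderiv (f r)) z - poly (f r) z * poly (pderiv (g r)) z"
        by (simp add: wronskian_def)
      moreover have "poly (pderiv (wronskian r)) z =
          poly (g r) z * poly (pderiv (pderiv (f r))) z - poly (f r) z * poly (pderiv (pderiv (g r))) z"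
        by (simp add: wronskian_def pderiv_diff pderiv_mult algebra_simps)
      ultimately show ?thesis
        unfolding poly_jacobi_div_power of_real_mult by (simp add: ring_distribs mult_ac)
    qed
    have off: "of_real (kap r) * poly (jacobi_div \<alpha> \<beta> ([:1, -1:] ^ (l - Suc r) * h r)) z =
        of_real (kap r) * (1 - z) ^ (l - r) * ?F r - of_real (kap r) * (1 - z) ^ (l - Suc r) * ?B (Suc r)"
      if r: "r < l" for r
    proof -
      have e: "(1 - z) ^ (l - r) = (1 - z) * (1 - z) ^ (l - Suc r)"
        using r by (simp flip: power_Suc add: Suc_diff_Suc)
      have "real (l - Suc r) = real l - real r - 1" using r by (simp add: of_nat_diff)
      hence ze: "of_real (ze (Suc r)) = of_real \<beta> * (1 - z) / z - of_real (\<alpha> + 1 + (l - Suc r)) - (1 - z) * of_real (xi r)"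
        by (simp add: ze_def xi_def z_def algebra_simps)
      have c: "poly (cross r) z = poly (g r) z * poly (f (Suc r)) z - poly (f r) z * poly (g (Suc r)) z"
        by (simp add: cross_def)
      have c': "poly (pderiv (cross r)) z =
          poly (g r) z * poly (pderiv (f (Suc r))) z + poly (pderiv (g r)) z * poly (f (Suc r)) z
          - poly (f r) z * poly (pderiv (g (Suc r))) z - poly (pderiv (f r)) z * poly (g (Suc r)) z"
        by (simp add: cross_def pderiv_diff pderiv_mult algebra_simps)
      show ?thesis
        unfolding poly_jacobi_div_power_quotient[OF h z] e c c' forward_def backward_def ze diff_Suc_1
        by Groebner_Basis.algebra
    qed
    have "(\<Sum>r\<le>l. ?S r) = (\<Sum>r\<le>l. of_real (weight_coeff \<beta> k l r * lam r) * poly (jacobi_div \<alpha> \<beta> ([:1, -1:] ^ (l - r) * wronskian r)) z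
        + of_real (kap r) * (1 - z) ^ (l - r) * ?F r
        - of_real (weight_coeff \<beta> k l r * (3 * real r * (real l + k - real r))) * (1 - z) ^ (l - r) * ?B r)"
    proof (intro sum.cong refl)
      fix r assume "r \<in> {..l}"
      hence r: "r \<le> l" by simp
      have w: "complex_of_real (weight_coeff \<beta> k l r * (1 - u) ^ (l - r)) = of_real (weight_coeff \<beta> k l r) * (1 - z) ^ (l - r)"
        by (simp add: z_def)
      show "?S r = of_real (weight_coeff \<beta> k l r * lam r) * poly (jacobi_div \<alpha> \<beta> ([:1, -1:] ^ (l - r) * wronskian r)) z
        + of_real (kap r) * (1 - z) ^ (l - r) * ?F r
        - of_real (weight_coeff \<beta> k l r * (3 * real r * (real l + k - real r))) * (1 - z) ^ (l - r) * ?B r"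
        unfolding diag[OF r] transformed[OF r] w kap_def f_def[symmetric] g_def[symmetric]
        unfolding of_real_mult[of "weight_coeff \<beta> k l r"]
        by Groebner_Basis.algebra
    qed
    also have "\<dots> = (\<Sum>r\<le>l. of_real (weight_coeff \<beta> k l r * lam r) * poly (jacobi_div \<alpha> \<beta> ([:1, -1:] ^ (l - r) * wronskian r)) z)
        + (\<Sum>r\<le>l. of_real (kap r) * (1 - z) ^ (l - r) * ?F r)
        - (\<Sum>r\<le>l. of_real (weight_coeff \<beta> k l r * (3 * real r * (real l + k - real r))) * (1 - z) ^ (l - r) * ?B r)"
      by (simp only: sum.distrib sum_subtractf)
    also have "(\<Sum>r\<le>l. of_real (kap r) * (1 - z) ^ (l - r) * ?F r) = (\<Sum>r<l. of_real (kap r) * (1 - z) ^ (l - r) * ?F r)"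
      by (simp add: kap_def flip: lessThan_Suc_atMost)
    also have "(\<Sum>r\<le>l. of_real (weight_coeff \<beta> k l r * (3 * real r * (real l + k - real r))) * (1 - z) ^ (l - r) * ?B r) =
        (\<Sum>r<l. of_real (weight_coeff \<beta> k l (Suc r) * (3 * real (Suc r) * (real l + k - real (Suc r)))) * (1 - z) ^ (l - Suc r) * ?B (Suc r))"
      by (subst sum.atMost_shift) simp
    also have "\<dots> = (\<Sum>r<l. of_real (kap r) * (1 - z) ^ (l - Suc r) * ?B (Suc r))"
      by (intro sum.cong refl) (simp add: kap)
    also have "(\<Sum>r\<le>l. of_real (weight_coeff \<beta> k l r * lam r) * poly (jacobi_div \<alpha> \<beta> ([:1, -1:] ^ (l - r) * wronskian r)) z)
        + (\<Sum>r<l. of_real (kap r) * (1 - z) ^ (l - r) * ?F r)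
        - (\<Sum>r<l. of_real (kap r) * (1 - z) ^ (l - Suc r) * ?B (Suc r)) =
        (\<Sum>r\<le>l. of_real (weight_coeff \<beta> k l r * lam r) * poly (jacobi_div \<alpha> \<beta> ([:1, -1:] ^ (l - r) * wronskian r)) z)
        + (\<Sum>r<l. of_real (kap r) * poly (jacobi_div \<alpha> \<beta> ([:1, -1:] ^ (l - Suc r) * h r)) z)"
      by (simp add: off sum_subtractf)
    also have "\<dots> = poly (jacobi_div \<alpha> \<beta> R) z"
      by (simp only: R_def jacobi_div_add jacobi_div_sum jacobi_div_smult poly_add poly_sum poly_smult)
    finally show "(\<Sum>r\<le>l. of_real (weight_coeff \<beta> k l r * (1 - u) ^ (l - r)) *
       (poly (binomial_comb l q r) (of_real u) * (\<Sum>i\<le>l. of_real (binomial_entry r u i) * E_vec \<alpha> \<beta> k l p u i)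
      - poly (binomial_comb l p r) (of_real u) * (\<Sum>i\<le>l. of_real (binomial_entry r u i) * E_vec \<alpha> \<beta> k l q u i)))
      = poly (jacobi_div \<alpha> \<beta> R) (of_real u)"
      unfolding f_def g_def z_def .
  qed
qed

section \<open>Symmetry for matrix valued polynomials\<close>

lemma mat_adjoint_mult_entry:
  fixes A B M :: "complex mat"
  assumes "A \<in> carrier_mat n n" "M \<in> carrier_mat n n" "B \<in> carrier_mat n n" "a < n" "b < n"
  shows "(mat_adjoint A * M * B) $$ (a, b) =
    (\<Sum>i<n. \<Sum>j<n. cnj (A $$ (i, a)) * M $$ (i, j) * B $$ (j, b))"
proof -
  have "(mat_adjoint A * M * B) $$ (a, b) =
      (\<Sum>j<n. (\<Sum>i<n. cnj (A $$ (i, a)) * M $$ (i, j)) * B $$ (j, b))"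
    using assms
    by (simp add: scalar_prod_def mat_adjoint_def mat_of_rows_def conjugate_complex_def
        atLeast0LessThan)
  also have "\<dots> = (\<Sum>i<n. \<Sum>j<n. cnj (A $$ (i, a)) * M $$ (i, j) * B $$ (j, b))"
    unfolding sum_distrib_right by (rule sum.swap)
  finally show ?thesis .
qed

lemma mat_deriv_poly:
  "mat_deriv (\<lambda>u. map_mat (\<lambda>q. poly q (complex_of_real u)) p) =
     (\<lambda>u. map_mat (\<lambda>q. poly q (of_real u)) (map_mat pderiv p))"
  by (intro ext eq_matI)
     (auto simp: mat_deriv_def intro!: vector_derivative_at poly_of_real_has_vector_derivative)

lemma E_op_entry:
  assumes "p \<in> carrier_mat (l + 1) (l + 1)" "i \<le> l" "b \<le> l"
  shows "E_op \<alpha> \<beta> k l (\<lambda>u. map_mat (\<lambda>q. poly q (complex_of_real u)) p) u $$ (i, b) =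
     E_vec \<alpha> \<beta> k l (\<lambda>j. p $$ (j, b)) u i"
proof -
  have s: "{0..<Suc l} = {..l}" by auto
  have 2: "complex_of_real (1 - u) * (Q0_mat l $$ (i, j) + complex_of_real u * Q1_mat \<alpha> l $$ (i, j)) =
      of_real (E2_entry \<alpha> l u i j)" if "j \<le> l" for j
    using assms that by (auto simp: Q0_mat_def Q1_mat_def E2_entry_def tridiag_def)
  have 1: "P0_mat \<alpha> \<beta> k l $$ (i, j) + complex_of_real u * P1_mat \<alpha> \<beta> k l $$ (i, j) =
      of_real (E1_entry \<alpha> \<beta> k l u i j)" if "j \<le> l" for j
    using assms that by (auto simp: P0_mat_def P1_mat_def E1_entry_def tridiag_def)
  have 0: "complex_of_real (\<alpha> + 2 * real l + 3 * k) * V_mat \<alpha> \<beta> k l $$ (i, j) =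
      - of_real (E0_entry \<alpha> \<beta> k l i j)" if "j \<le> l" for j
    using assms that by (auto simp: V_mat_def E0_entry_def tridiag_def algebra_simps)
  have d: "Q0_mat l \<in> carrier_mat (l + 1) (l + 1)" "Q1_mat \<alpha> l \<in> carrier_mat (l + 1) (l + 1)"
    "P0_mat \<alpha> \<beta> k l \<in> carrier_mat (l + 1) (l + 1)" "P1_mat \<alpha> \<beta> k l \<in> carrier_mat (l + 1) (l + 1)"
    "V_mat \<alpha> \<beta> k l \<in> carrier_mat (l + 1) (l + 1)"
    by (simp_all add: Q0_mat_def Q1_mat_def P0_mat_def P1_mat_def V_mat_def)
  have "E_op \<alpha> \<beta> k l (\<lambda>u. map_mat (\<lambda>q. poly q (complex_of_real u)) p) u $$ (i, b) =
     (\<Sum>j\<le>l. complex_of_real (1 - u) * (Q0_mat l $$ (i, j) + complex_of_real u * Q1_mat \<alpha> l $$ (i, j))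
        * poly (pderiv (pderiv (p $$ (j, b)))) (of_real u))
     + (\<Sum>j\<le>l. (P0_mat \<alpha> \<beta> k l $$ (i, j) + complex_of_real u * P1_mat \<alpha> \<beta> k l $$ (i, j))
        * poly (pderiv (p $$ (j, b))) (of_real u))
     - (\<Sum>j\<le>l. complex_of_real (\<alpha> + 2 * real l + 3 * k) * V_mat \<alpha> \<beta> k l $$ (i, j) * poly (p $$ (j, b)) (of_real u))"
    unfolding E_op_def mat_deriv_poly using d assms
    by (simp add: scalar_prod_def s del: of_real_add of_real_diff)
  also have "\<dots> = E_vec \<alpha> \<beta> k l (\<lambda>j. p $$ (j, b)) u i"
    unfolding E_vec_def sum.distrib
    by (simp add: 0 1 2 sum_negf del: of_real_add of_real_diff of_real_mult)
  finally show ?thesis .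
qed

lemma pderiv_map_poly_cnj: "pderiv (map_poly cnj p) = map_poly cnj (pderiv p)"
  by (rule poly_eqI) (simp add: coeff_pderiv coeff_map_poly)

lemma poly_map_poly_cnj_of_real: "poly (map_poly cnj p) (of_real u) = cnj (poly p (of_real u))"
  using poly_cnj[of p "of_real u"] by simp

text \<open>The coefficients of \<open>E\<close> are real, so conjugation turns the sesquilinear pairing into a bilinear one.\<close>
lemma cnj_E_vec: "cnj (E_vec \<alpha> \<beta> k l p u i) = E_vec \<alpha> \<beta> k l (\<lambda>j. map_poly cnj (p j)) u i"
  by (simp add: E_vec_def cnj_sum pderiv_map_poly_cnj poly_map_poly_cnj_of_real)

lemma continuous_on_E_vec [continuous_intros]:
  "continuous_on S (\<lambda>u. E_vec \<alpha> \<beta> k l p u i)"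
proof -
  have "continuous_on S (\<lambda>u. E2_entry \<alpha> l u i j)" "continuous_on S (\<lambda>u. E1_entry \<alpha> \<beta> k l u i j)" for j
    unfolding E2_entry_def E1_entry_def tridiag_def
    by (cases "j = i"; cases "j + 1 = i"; cases "j = i + 1"; simp; intro continuous_intros)+
  thus ?thesis
    unfolding E_vec_def by (intro continuous_intros)
qed

definition Z_entry :: "real \<Rightarrow> real \<Rightarrow> nat \<Rightarrow> real \<Rightarrow> nat \<Rightarrow> nat \<Rightarrow> real" where
  "Z_entry \<beta> k l u i j = (\<Sum>r\<le>l. weight_coeff \<beta> k l r * (1 - u) ^ (l - r) * (binomial_entry r u i * binomial_entry r u j))"

lemma W_mat_entry:
  assumes "i \<le> l" "j \<le> l"
  shows "W_mat \<alpha> \<beta> k l u $$ (i, j) = of_real (jacobi_weight \<alpha> \<beta> u) * of_real (Z_entry \<beta> k l u i j)"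
proof -
  have "(\<Sum>r = 0..l. real (r choose i) * real (r choose j)
        * ((real l + k - 1 - real r) gchoose (l - r)) * ((\<beta> - k + real r) gchoose r)
        * (1 - u) ^ (l - r) * u ^ (i + j)) = Z_entry \<beta> k l u i j" (is "?s = _")
    unfolding Z_entry_def atLeast0AtMost
    by (intro sum.cong) (simp_all add: weight_coeff_def binomial_entry_def power_add mult_ac)
  hence Z: "Z_entry \<beta> k l u i j = ?s" ..
  show ?thesis
    unfolding Z using assms by (simp add: W_mat_def Z_mat_def jacobi_weight_def)
qed

text \<open>The factorisation \<open>Z = X\<^sup>T D X\<close>, read as an identity of bilinear forms.\<close>
lemma sum_Z_entry:
  "(\<Sum>i\<le>l. \<Sum>j\<le>l. x i * of_real (Z_entry \<beta> k l u i j) * (y j :: complex)) =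
    (\<Sum>r\<le>l. of_real (weight_coeff \<beta> k l r * (1 - u) ^ (l - r)) *
       ((\<Sum>i\<le>l. of_real (binomial_entry r u i) * x i) * (\<Sum>j\<le>l. of_real (binomial_entry r u j) * y j)))"
proof -
  have "(\<Sum>i\<le>l. \<Sum>j\<le>l. x i * of_real (Z_entry \<beta> k l u i j) * y j) =
      (\<Sum>i\<le>l. \<Sum>j\<le>l. \<Sum>r\<le>l. of_real (weight_coeff \<beta> k l r * (1 - u) ^ (l - r)) *
         ((of_real (binomial_entry r u i) * x i) * (of_real (binomial_entry r u j) * y j)))"
    by (simp add: Z_entry_def sum_distrib_left sum_distrib_right mult_ac)
  also have "\<dots> = (\<Sum>i\<le>l. \<Sum>r\<le>l. \<Sum>j\<le>l. of_real (weight_coeff \<beta> k l r * (1 - u) ^ (l - r)) *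
         ((of_real (binomial_entry r u i) * x i) * (of_real (binomial_entry r u j) * y j)))"
    by (rule sum.cong[OF refl sum.swap])
  also have "\<dots> = (\<Sum>r\<le>l. \<Sum>i\<le>l. \<Sum>j\<le>l. of_real (weight_coeff \<beta> k l r * (1 - u) ^ (l - r)) *
         ((of_real (binomial_entry r u i) * x i) * (of_real (binomial_entry r u j) * y j)))"
    by (rule sum.swap)
  also have "\<dots> = (\<Sum>r\<le>l. of_real (weight_coeff \<beta> k l r * (1 - u) ^ (l - r)) *
       ((\<Sum>i\<le>l. of_real (binomial_entry r u i) * x i) * (\<Sum>j\<le>l. of_real (binomial_entry r u j) * y j)))"
    by (simp only: sum_product) (simp only: sum_distrib_left)
  finally show ?thesis .
qed

text \<open>Symmetry for single columns. Both integrals exist since \<open>\<alpha>\<close> and \<open>\<beta>\<close> exceed \<open>-1\<close>, and the difference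
  of the integrands is an exact derivative with vanishing boundary terms.\<close>
lemma vector_symmetry:
  assumes "\<alpha> > -1" "\<beta> > -1"
  shows "(LBINT u:{0<..<1}. of_real (jacobi_weight \<alpha> \<beta> u) *
           (\<Sum>i\<le>l. \<Sum>j\<le>l. poly (q i) (of_real u) * of_real (Z_entry \<beta> k l u i j) * E_vec \<alpha> \<beta> k l p u j)) =
         (LBINT u:{0<..<1}. of_real (jacobi_weight \<alpha> \<beta> u) *
           (\<Sum>i\<le>l. \<Sum>j\<le>l. E_vec \<alpha> \<beta> k l q u i * of_real (Z_entry \<beta> k l u i j) * poly (p j) (of_real u)))"
    (is "(LBINT u:_. ?w u * ?D1 u) = (LBINT u:_. ?w u * ?D2 u)")
proof -
  have Z: "continuous_on {0..1} (\<lambda>u. Z_entry \<beta> k l u i j)" for i j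
    unfolding Z_entry_def binomial_entry_def by (intro continuous_intros)
  have i1: "set_integrable lborel {0<..<1} (\<lambda>u. ?w u * ?D1 u)"
    by (intro jacobi_weight_integrable assms continuous_intros Z)
  have i2: "set_integrable lborel {0<..<1} (\<lambda>u. ?w u * ?D2 u)"
    by (intro jacobi_weight_integrable assms continuous_intros Z)
  obtain R where R: "\<And>u. u \<noteq> 0 \<Longrightarrow>
    (\<Sum>r\<le>l. of_real (weight_coeff \<beta> k l r * (1 - u) ^ (l - r)) *
       (poly (binomial_comb l q r) (of_real u) * (\<Sum>i\<le>l. of_real (binomial_entry r u i) * E_vec \<alpha> \<beta> k l p u i)
      - poly (binomial_comb l p r) (of_real u) * (\<Sum>i\<le>l. of_real (binomial_entry r u i) * E_vec \<alpha> \<beta> k l q u i)))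
    = poly (jacobi_div \<alpha> \<beta> R) (of_real u)"
    by (rule skew_density_is_jacobi_div[where p = p and q = q and \<alpha> = \<alpha> and \<beta> = \<beta> and k = k and l = l]) (rule that, blast)
  have "(LBINT u:{0<..<1}. ?w u * ?D1 u) - (LBINT u:{0<..<1}. ?w u * ?D2 u) =
      (LBINT u:{0<..<1}. ?w u * ?D1 u - ?w u * ?D2 u)"
    by (rule set_integral_diff(2)[OF i1 i2, symmetric])
  also have "\<dots> = (LBINT u:{0<..<1}. ?w u * poly (jacobi_div \<alpha> \<beta> R) (of_real u))"
  proof (rule set_lebesgue_integral_cong)
    show "\<forall>u. u \<in> {0<..<1} \<longrightarrow> ?w u * ?D1 u - ?w u * ?D2 u = ?w u * poly (jacobi_div \<alpha> \<beta> R) (of_real u)"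
    proof (intro allI impI)
      fix u :: real assume "u \<in> {0<..<1}"
      hence u: "u \<noteq> 0" by simp
      have "?D1 u - ?D2 u = poly (jacobi_div \<alpha> \<beta> R) (of_real u)"
        unfolding R[OF u, symmetric] sum_Z_entry poly_binomial_comb sum_subtractf[symmetric]
        by (intro sum.cong refl) Groebner_Basis.algebra
      thus "?w u * ?D1 u - ?w u * ?D2 u = ?w u * poly (jacobi_div \<alpha> \<beta> R) (of_real u)"
        by (simp only: right_diff_distrib[symmetric])
    qed
  qed simp
  also have "\<dots> = 0"
    by (rule integral_jacobi_div[OF assms])
  finally show ?thesis by simp
qed

theorem theorem3p1:
  fixes \<alpha> \<beta> k :: real and l :: nat
  assumes "\<alpha> > -1" and "\<beta> > -1"
    and "0 < k" and "k < \<beta> + 1"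
    and "l \<ge> 1"
  shows "symmetric_wrt (l + 1) (W_mat \<alpha> \<beta> k l) (E_op \<alpha> \<beta> k l)"
  unfolding symmetric_wrt_def
proof (intro allI impI)
  fix P Q assume "mat_polynomial (l + 1) P" "mat_polynomial (l + 1) Q"
  then obtain p q where pq: "p \<in> carrier_mat (l + 1) (l + 1)" "q \<in> carrier_mat (l + 1) (l + 1)"
    and P: "P = (\<lambda>u. map_mat (\<lambda>x. poly x (complex_of_real u)) p)"
    and Q: "Q = (\<lambda>u. map_mat (\<lambda>x. poly x (complex_of_real u)) q)"
    unfolding mat_polynomial_def by blast
  have W: "W_mat \<alpha> \<beta> k l u \<in> carrier_mat (l + 1) (l + 1)" for u
    by (simp add: W_mat_def Z_mat_def)
  have E: "E_op \<alpha> \<beta> k l (\<lambda>u. map_mat (\<lambda>x. poly x (complex_of_real u)) x) u \<in> carrier_mat (l + 1) (l + 1)"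
    if "x \<in> carrier_mat (l + 1) (l + 1)" for x u
    unfolding E_op_def using that
    by (intro carrier_matI) (simp_all add: V_mat_def)
  have s: "{..<l + 1} = {..l}" by auto
  show "mat_inner (l + 1) (W_mat \<alpha> \<beta> k l) (E_op \<alpha> \<beta> k l P) Q =
      mat_inner (l + 1) (W_mat \<alpha> \<beta> k l) P (E_op \<alpha> \<beta> k l Q)"
  proof (rule eq_matI)
    fix a b
    assume "a < dim_row (mat_inner (l + 1) (W_mat \<alpha> \<beta> k l) P (E_op \<alpha> \<beta> k l Q))"
      and "b < dim_col (mat_inner (l + 1) (W_mat \<alpha> \<beta> k l) P (E_op \<alpha> \<beta> k l Q))"
    hence ab: "a < l + 1" "b < l + 1" by (simp_all add: mat_inner_def mat_integral_def)
    let ?p = "\<lambda>j. p $$ (j, b)" and ?q = "\<lambda>i. map_poly cnj (q $$ (i, a))"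
    have 1: "(mat_adjoint (Q u) * W_mat \<alpha> \<beta> k l u * E_op \<alpha> \<beta> k l P u) $$ (a, b) =
        of_real (jacobi_weight \<alpha> \<beta> u) *
        (\<Sum>i\<le>l. \<Sum>j\<le>l. poly (?q i) (of_real u) * of_real (Z_entry \<beta> k l u i j) * E_vec \<alpha> \<beta> k l ?p u j)" for u
    proof -
      have m: "map_mat (\<lambda>x. poly x (complex_of_real u)) q \<in> carrier_mat (l + 1) (l + 1)"
        using pq by simp
      show ?thesis
        unfolding P Q mat_adjoint_mult_entry[OF m W E[OF pq(1)] ab] s sum_distrib_left
        using ab pq by (intro sum.cong refl) (simp add: E_op_entry W_mat_entry poly_map_poly_cnj_of_real)
    qed
    have 2: "(mat_adjoint (E_op \<alpha> \<beta> k l Q u) * W_mat \<alpha> \<beta> k l u * P u) $$ (a, b) =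
        of_real (jacobi_weight \<alpha> \<beta> u) *
        (\<Sum>i\<le>l. \<Sum>j\<le>l. E_vec \<alpha> \<beta> k l ?q u i * of_real (Z_entry \<beta> k l u i j) * poly (?p j) (of_real u))" for u
    proof -
      have m: "map_mat (\<lambda>x. poly x (complex_of_real u)) p \<in> carrier_mat (l + 1) (l + 1)"
        using pq by simp
      show ?thesis
        unfolding P Q mat_adjoint_mult_entry[OF E[OF pq(2)] W m ab] s sum_distrib_left
        using ab pq by (intro sum.cong refl) (simp add: E_op_entry W_mat_entry cnj_E_vec)
    qed
    show "mat_inner (l + 1) (W_mat \<alpha> \<beta> k l) (E_op \<alpha> \<beta> k l P) Q $$ (a, b) =
        mat_inner (l + 1) (W_mat \<alpha> \<beta> k l) P (E_op \<alpha> \<beta> k l Q) $$ (a, b)"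
      using ab vector_symmetry[OF assms(1,2), where l = l and k = k and p = ?p and q = ?q]
      by (simp add: mat_inner_def mat_integral_def 1 2)
  qed (simp_all add: mat_inner_def mat_integral_def)
qed

end
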